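(* For every integer $m\ge 0$ and every $q\in\mathbb C$ with $|q|<1$, $$U_m(q):=\sum_{n\ge 1}u(m,n)q^n=\frac{q^{\frac{m(m+1)}{2}}}{(q)_\infty}\sum_{n\ge 1}\frac{(-1)^n q^{\frac{n(n+1)}{2}+mn}}{1-q^{n+m}}\left(q^{n(n+m)}-1\right).$$ In particular, $u\!\left(m,\tfrac12(m+2)(m+1)+n\right)=p(n)$ for all integers $0\le n\le m+1$.
   Context: A strongly unimodal sequence of size $n$ is a finite sequence of positive integers $\{a_j\}_{j=1}^s$ with $a_1<\dots<a_{k-1}<a_k>a_{k+1}>\dots>a_s$ for some $k\in\{1,\dots,s\}$ and $a_1+\dots+a_s=n$. Its rank is $s-2k+1$ (the number of terms after the peak $a_k$ minus the number of terms before it). $u(m,n)$ denotes the number of strongly unimodal sequences of size $n$ and rank $m$. $(a)_m=(a;q)_m:=\prod_{j=0}^{m-1}(1-aq^j)$ for $m\in\mathbb N_0\cup\{\infty\}$, and $p(n)$ is the number of integer partitions of $n$. *)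

theory Defs
  imports "HOL-Analysis.Analysis" "HOL-Library.Multiset"
begin

text \<open>
  A sequence \<open>a\<^sub>1, \<dots>, a\<^sub>s\<close> is a list, and \<open>k\<close> is the
  1-based position of the peak: \<open>take k a\<close> is \<open>a\<^sub>1, \<dots>, a\<^sub>k\<close>
  and \<open>drop (k - 1) a\<close> is \<open>a\<^sub>k, \<dots>, a\<^sub>s\<close>, so both contain the peak.
\<close>
definition is_peak :: "nat list \<Rightarrow> nat \<Rightarrow> bool" where
  "is_peak a k \<longleftrightarrow> k \<in> {1..length a} \<and>
     sorted_wrt (<) (take k a) \<and> sorted_wrt (>) (drop (k - 1) a)"

definition strongly_unimodal :: "nat list \<Rightarrow> bool" where
  "strongly_unimodal a \<longleftrightarrow> (\<forall>x\<in>set a. 0 < x) \<and> (\<exists>k. is_peak a k)"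

text \<open>The peak position of a strongly unimodal sequence is unique.\<close>
definition unimodal_rank :: "nat list \<Rightarrow> int" where
  "unimodal_rank a = int (length a) - 2 * int (THE k. is_peak a k) + 1"

definition u :: "int \<Rightarrow> nat \<Rightarrow> nat" where
  "u m n = card {a. strongly_unimodal a \<and> sum_list a = n \<and> unimodal_rank a = m}"

definition U :: "int \<Rightarrow> complex \<Rightarrow> complex" where
  "U m q = (\<Sum>\<^sub>\<infinity>n\<in>{1..}. of_nat (u m n) * q ^ n)"

text \<open>The infinite q-Pochhammer symbol \<open>(a; q)\<^sub>\<infinity>\<close>.\<close>
definition qpoch_inf :: "complex \<Rightarrow> complex \<Rightarrow> complex" where
  "qpoch_inf a q = (\<Prod>j. 1 - a * q ^ j)"

text \<open>The number of integer partitions of \<open>n\<close>, as multisets of positive parts.\<close>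
definition partition_count :: "nat \<Rightarrow> nat" where
  "partition_count n = card {M :: nat multiset. 0 \<notin># M \<and> sum_mset M = n}"

end

theory Submission
  imports Defs
begin

text \<open>
  A strongly unimodal sequence with peak \<open>N + 1\<close> is a pair of subsets \<open>A, B\<close> of
  \<open>{1, \<dots>, N}\<close>, and its rank is \<open>|B| - |A|\<close>. By the finite Jacobi triple product the generating
  function \<open>c\<^sub>N(m)\<close> of these pairs satisfies \<open>c\<^sub>N(m) + c\<^sub>N(m + 1) = q\<^bsup>m(m+1)/2\<^esup> [2N+1, N-m]\<close>, hence
  is an alternating sum of Gaussian binomials. Summing over \<open>N\<close> first leaves the series
  \<open>\<Sum>\<^sub>r q\<^sup>r [2r+a, r]\<close>, which counts the partitions of Dyson rank at most \<open>a + 1\<close>. Dyson's recursion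
  evaluates it as \<open>\<Sum>\<^sub>n (-1)\<^sup>n q\<^bsup>n(3n+2a+3)/2\<^esup> / (q)\<^sub>\<infinity>\<close>, and collecting the terms of the
  resulting double series in \<open>(i, n)\<close> with \<open>i + n + 1 = k\<close> gives finite geometric sums.

  For the coefficients near the lowest order, no part can precede the peak, and subtracting
  \<open>1, \<dots>, m + 1\<close> from the parts yields an arbitrary partition of \<open>n\<close>.
\<close>

section \<open>Gaussian binomials and the partition rank\<close>

definition qpoch :: "complex \<Rightarrow> nat \<Rightarrow> complex" where
  "qpoch q n = (\<Prod>j<n. 1 - q ^ Suc j)"

text \<open>The Gaussian binomial coefficient \<open>[a + b, a]\<close>.\<close>
definition gauss :: "complex \<Rightarrow> nat \<Rightarrow> nat \<Rightarrow> complex" where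
  "gauss q a b = qpoch q (a + b) / (qpoch q a * qpoch q b)"

lemma qpoch_0 [simp]: "qpoch q 0 = 1"
  by (simp add: qpoch_def)

lemma qpoch_Suc [simp]: "qpoch q (Suc n) = (1 - q ^ Suc n) * qpoch q n"
  by (simp add: qpoch_def mult.commute)

section \<open>Nonvanishing of the factors and the two Pascal rules\<close>

lemma one_minus_power_nonzero:
  fixes q :: complex
  assumes "norm q < 1" "n > 0"
  shows "1 - q ^ n \<noteq> 0"
proof
  assume "1 - q ^ n = 0"
  hence "norm q ^ n = 1"
    by (metis eq_iff_diff_eq_0 norm_one norm_power)
  thus False
    using power_Suc_less_one[of "norm q" "n - 1"] assms by (cases "norm q = 0") (auto simp: power_0_left)
qed

lemma qpoch_nonzero: "norm q < 1 \<Longrightarrow> qpoch q n \<noteq> 0"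
  unfolding qpoch_def using one_minus_power_nonzero[of q "Suc _"] by simp

lemma gauss_0_left [simp]: "norm q < 1 \<Longrightarrow> gauss q 0 b = 1"
  by (simp add: gauss_def qpoch_nonzero)

lemma gauss_0_right [simp]: "norm q < 1 \<Longrightarrow> gauss q a 0 = 1"
  by (simp add: gauss_def qpoch_nonzero)

text \<open>Writing \<open>1 - x * y\<close> as \<open>(1 - x) + x * (1 - y)\<close>, with
  \<open>x\<close> and \<open>y\<close> the top powers of the two denominator factors, lets each
  summand cancel one factor.\<close>

lemma gauss_pascal1:
  assumes "norm q < 1"
  shows "gauss q (Suc a) (Suc b) = gauss q a (Suc b) + q ^ Suc a * gauss q (Suc a) b"
proof -
  define x y where "x = q ^ Suc a" and "y = q ^ Suc b"
  have xy: "q ^ Suc (Suc (a + b)) = x * y" by (simp add: x_def y_def power_add)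
  have "1 - x \<noteq> 0" "1 - y \<noteq> 0" "qpoch q a \<noteq> 0" "qpoch q b \<noteq> 0"
    unfolding x_def y_def using assms by (intro one_minus_power_nonzero qpoch_nonzero; simp)+
  moreover have "(X + x * Y) * t / (X * A * (Y * B)) = t / (A * (Y * B)) + x * (t / (X * A * B))"
    if "X \<noteq> 0" "Y \<noteq> 0" "A \<noteq> 0" "B \<noteq> 0" for X Y t A B :: complex
    using that by (simp add: field_simps)
  moreover have "1 - x * y = (1 - x) + x * (1 - y)"
    by (simp add: algebra_simps)
  ultimately show ?thesis
    by (simp only: gauss_def add_Suc add_Suc_right qpoch_Suc xy flip: x_def y_def)
qed

lemma gauss_commute: "gauss q a b = gauss q b a"
  by (simp add: gauss_def ac_simps)

lemma gauss_pascal2: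
  assumes "norm q < 1"
  shows "gauss q (Suc a) (Suc b) = gauss q (Suc a) b + q ^ Suc b * gauss q a (Suc b)"
  using gauss_pascal1[OF assms, of b a] by (simp add: gauss_commute)

section \<open>Limits and uniform bounds for growing boxes\<close>

lemma convergent_prod_qpoch:
  fixes q :: complex
  assumes "norm q < 1"
  shows "convergent_prod (\<lambda>j. 1 - q * q ^ j)"
proof (intro abs_convergent_prod_imp_convergent_prod summable_imp_abs_convergent_prod)
  show "summable (\<lambda>j. norm (1 - q * q ^ j - 1))"
    using assms by (simp add: norm_mult norm_power summable_geometric summable_mult)
qed

lemma qpoch_tendsto:
  assumes "norm q < 1"
  shows "qpoch q \<longlonglongrightarrow> qpoch_inf q q"
proof -
  have "(\<lambda>n. \<Prod>j\<le>n. 1 - q * q ^ j) \<longlonglongrightarrow> qpoch_inf q q"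
    unfolding qpoch_inf_def by (rule convergent_prod_LIMSEQ[OF convergent_prod_qpoch[OF assms]])
  hence "(\<lambda>n. qpoch q (Suc n)) \<longlonglongrightarrow> qpoch_inf q q"
    by (simp only: qpoch_def lessThan_Suc_atMost power_Suc)
  thus ?thesis by (rule LIMSEQ_imp_Suc)
qed

lemma qpoch_inf_nonzero:
  assumes "norm q < 1"
  shows "qpoch_inf q q \<noteq> 0"
  unfolding qpoch_inf_def
proof (rule prodinf_nonzero[OF convergent_prod_qpoch[OF assms]])
  show "1 - q * q ^ j \<noteq> 0" for j
    using one_minus_power_nonzero[OF assms, of "Suc j"] by simp
qed

lemma gauss_tendsto:
  assumes "norm q < 1" "filterlim f at_top sequentially" "filterlim g at_top sequentially"
  shows "(\<lambda>n. gauss q (f n) (g n)) \<longlonglongrightarrow> 1 / qpoch_inf q q"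
proof -
  note t = filterlim_compose[OF qpoch_tendsto[OF assms(1)]]
  have "filterlim (\<lambda>n. f n + g n) at_top sequentially"
    by (rule filterlim_at_top_mono[OF assms(2)]) auto
  hence "(\<lambda>n. gauss q (f n) (g n)) \<longlonglongrightarrow> qpoch_inf q q / (qpoch_inf q q * qpoch_inf q q)"
    unfolding gauss_def using assms qpoch_inf_nonzero[OF assms(1)] by (intro tendsto_intros t) auto
  thus ?thesis using qpoch_inf_nonzero[OF assms(1)] by simp
qed

text \<open>Both \<open>qpoch q\<close> and its reciprocal converge, the latter because the infinite
  product is nonzero, so both are bounded. One constant for all boxes lets the series below be
  dominated by geometric ones.\<close>

lemma gauss_bounded:
  assumes "norm q < 1"
  obtains C where "C > 0" "\<And>a b. norm (gauss q a b) \<le> C"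
proof -
  have "Bseq (qpoch q)" "Bseq (\<lambda>n. inverse (qpoch q n))"
    using qpoch_tendsto[OF assms] tendsto_inverse[OF qpoch_tendsto[OF assms] qpoch_inf_nonzero[OF assms]]
    by (auto intro!: convergent_imp_Bseq simp: convergent_def)
  then obtain K L where K: "K > 0" "\<And>n. norm (qpoch q n) \<le> K"
    and L: "L > 0" "\<And>n. norm (inverse (qpoch q n)) \<le> L"
    unfolding Bseq_def by blast
  show ?thesis
  proof
    show "K * (L * L) > 0" using K L by simp
    show "norm (gauss q a b) \<le> K * (L * L)" for a b
    proof -
      have "norm (gauss q a b) =
          norm (qpoch q (a + b)) * (norm (inverse (qpoch q a)) * norm (inverse (qpoch q b)))"
        by (simp add: gauss_def norm_mult norm_divide norm_inverse field_simps)
      also have "\<dots> \<le> K * (L * L)"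
        using K L by (intro mult_mono) (auto intro: less_imp_le)
      finally show ?thesis .
    qed
  qed
qed

section \<open>Dyson's recursion for partitions of bounded rank\<close>

text \<open>
  Classify the partitions inside an \<open>R \<times> (R + a + 1)\<close> box by whether their rank
  exceeds \<open>a + 1\<close>.
\<close>
lemma gauss_rank_split:
  assumes "norm q < 1"
  shows "(\<Sum>r\<le>R. q ^ r * gauss q r (r + a)) +
           q ^ (a + 3) * (\<Sum>r<R - 1. q ^ r * gauss q r (r + (a + 3))) = gauss q R (R + a + 1)"
proof (induction R)
  case 0
  thus ?case using assms by simp
next
  case (Suc R)
  \<comment> \<open>The first Pascal rule isolates the new term \<open>r = Suc R\<close> of the
    first sum, the second one the new term \<open>r = R - 1\<close> of the other sum. For
    \<open>R = 0\<close> that other sum gains nothing.\<close>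
  have "gauss q (Suc R) (Suc R + a + 1) = gauss q R (R + a + 2) + q ^ Suc R * gauss q (Suc R) (Suc R + a)"
    using gauss_pascal1[OF assms, of R "Suc R + a"] by simp
  also have "gauss q R (R + a + 2) = gauss q R (R + a + 1) +
      (if R = 0 then 0 else q ^ (R + a + 2) * gauss q (R - 1) (R - 1 + (a + 3)))"
    using gauss_pascal2[OF assms, of "R - 1" "R + a + 1"] assms
    by (cases R) (simp_all add: numeral_3_eq_3)
  finally have "gauss q (Suc R) (Suc R + a + 1) = gauss q R (R + a + 1) +
      (if R = 0 then 0 else q ^ (R + a + 2) * gauss q (R - 1) (R - 1 + (a + 3))) +
      q ^ Suc R * gauss q (Suc R) (Suc R + a)" .
  thus ?case using Suc.IH[symmetric]
    by (cases R) (simp_all add: algebra_simps power_add eval_nat_numeral)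
qed

lemma summable_norm_rank_gf_terms:
  assumes "norm q < 1"
  shows "summable (\<lambda>r. norm (q ^ r * gauss q r (r + a)))"
proof -
  obtain C where C: "C > 0" "\<And>a b. norm (gauss q a b) \<le> C"
    using gauss_bounded[OF assms] by blast
  show ?thesis
  proof (rule summable_comparison_test')
    show "summable (\<lambda>r. C * norm q ^ r)"
      using assms by (intro summable_mult summable_geometric) auto
    show "norm (norm (q ^ r * gauss q r (r + a))) \<le> C * norm q ^ r" for r
      using C(2)[of r "r + a"] mult_left_mono[of "norm (gauss q r (r + a))" C "norm q ^ r"]
      by (simp add: norm_mult norm_power ac_simps)
  qed
qed

text \<open>
  Adding 1 to the \<open>r\<close> parts of a partition in an \<open>r \<times> (r + a)\<close> box shows that this counts the
  partitions of rank (largest part minus number of parts) at most \<open>a + 1\<close>.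
\<close>
definition rank_gf :: "complex \<Rightarrow> nat \<Rightarrow> complex" where
  "rank_gf q a = (\<Sum>r. q ^ r * gauss q r (r + a))"

lemma rank_gf_sums:
  assumes "norm q < 1"
  shows "(\<lambda>r. q ^ r * gauss q r (r + a)) sums rank_gf q a"
  unfolding rank_gf_def by (rule summable_sums[OF summable_norm_cancel[OF summable_norm_rank_gf_terms[OF assms]]])

lemma rank_gf_bounded:
  assumes "norm q < 1"
  obtains C where "\<And>a. norm (rank_gf q a) \<le> C"
proof -
  obtain C where C: "C > 0" "\<And>a b. norm (gauss q a b) \<le> C"
    using gauss_bounded[OF assms] by blast
  have s: "summable (\<lambda>r. C * norm q ^ r)"
    using assms by (intro summable_mult summable_geometric) auto
  have "norm (rank_gf q a) \<le> (\<Sum>r. C * norm q ^ r)" for a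
    unfolding rank_gf_def
  proof (rule norm_suminf_le[OF _ s])
    show "norm (q ^ r * gauss q r (r + a)) \<le> C * norm q ^ r" for r
      using C(2)[of r "r + a"] mult_left_mono[of "norm (gauss q r (r + a))" C "norm q ^ r"]
      by (simp add: norm_mult norm_power ac_simps)
  qed
  thus ?thesis by (rule that)
qed

text \<open>As \<open>R\<close> grows in \<open>gauss_rank_split\<close>, the box fills up to all
  partitions, counted by \<open>1 / qpoch_inf q q\<close>; the subtracted term counts those of rank
  above \<open>a + 1\<close>.\<close>

lemma rank_gf_rec:
  assumes "norm q < 1"
  shows "rank_gf q a = 1 / qpoch_inf q q - q ^ (a + 3) * rank_gf q (a + 3)"
proof -
  have "(\<lambda>R. (\<Sum>r\<le>R. q ^ r * gauss q r (r + a))) \<longlonglongrightarrow> rank_gf q a"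
    using rank_gf_sums[OF assms] by (simp add: sums_def_le)
  moreover have "(\<lambda>R. (\<Sum>r<R - 1. q ^ r * gauss q r (r + (a + 3)))) \<longlonglongrightarrow> rank_gf q (a + 3)"
    by (rule filterlim_compose[OF rank_gf_sums[OF assms, unfolded sums_def] filterlim_minus_const_nat_at_top])
  ultimately have "(\<lambda>R. gauss q R (R + a + 1)) \<longlonglongrightarrow> rank_gf q a + q ^ (a + 3) * rank_gf q (a + 3)"
    unfolding gauss_rank_split[OF assms, symmetric] by (intro tendsto_intros)
  moreover have "(\<lambda>R. gauss q R (R + a + 1)) \<longlonglongrightarrow> 1 / qpoch_inf q q"
    by (rule gauss_tendsto[OF assms filterlim_ident filterlim_at_top_mono[OF filterlim_ident]]) auto
  ultimately show ?thesis by (metis LIMSEQ_unique eq_diff_eq)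
qed

text \<open>Iterate the recursion \<open>K\<close> times: the exponents \<open>a + 3 * j + 3\<close>
  for \<open>j < K\<close> add up to the half-product shown.\<close>

lemma rank_gf_partial:
  assumes "norm q < 1"
  shows "rank_gf q a = (\<Sum>n<K. (-1) ^ n * q ^ (n * (3 * n + 2 * a + 3) div 2)) / qpoch_inf q q
           + (-1) ^ K * q ^ (K * (3 * K + 2 * a + 3) div 2) * rank_gf q (a + 3 * K)"
proof (induction K)
  case (Suc K)
  \<comment> \<open>Naming the half \<open>e\<close> removes \<open>div\<close> and exposes the
    increment \<open>a + 3 * K + 3\<close> of the exponent.\<close>
  have "even (K * (3 * K + 2 * a + 3))" by simp
  then obtain e where e: "K * (3 * K + 2 * a + 3) = 2 * e" by blast
  have e': "Suc K * (3 * Suc K + 2 * a + 3) = 2 * (e + (a + 3 * K + 3))"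
    using e by (simp add: algebra_simps)
  show ?case
    unfolding Suc.IH rank_gf_rec[OF assms, of "a + 3 * K"] sum.lessThan_Suc e e'
    by (simp add: algebra_simps add_divide_distrib power_add)
qed simp

text \<open>The remainder in \<open>rank_gf_partial\<close> vanishes in the limit: its exponent is
  at least \<open>K\<close>, and \<open>rank_gf q\<close> is bounded uniformly in its last
  argument.\<close>

lemma rank_gf_expansion:
  assumes "norm q < 1"
  shows "(\<lambda>n. (-1) ^ n * q ^ (n * (3 * n + 2 * a + 3) div 2)) sums (qpoch_inf q q * rank_gf q a)"
proof -
  obtain C where C: "\<And>a. norm (rank_gf q a) \<le> C" using rank_gf_bounded[OF assms] by blast
  define r where "r K = (-1) ^ K * q ^ (K * (3 * K + 2 * a + 3) div 2) * rank_gf q (a + 3 * K)" for K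
  have "(\<lambda>K. norm q ^ K * C) \<longlonglongrightarrow> 0 * C"
    using assms by (intro tendsto_intros LIMSEQ_power_zero) auto
  moreover have "norm (r K) \<le> norm q ^ K * C" for K
  proof -
    have "K * 2 \<le> K * (3 * K + 2 * a + 3)" by (intro mult_le_mono) auto
    hence "K \<le> K * (3 * K + 2 * a + 3) div 2" by linarith
    hence "norm q ^ (K * (3 * K + 2 * a + 3) div 2) \<le> norm q ^ K"
      using assms by (intro power_decreasing) auto
    thus ?thesis unfolding r_def using C[of "a + 3 * K"]
      by (auto simp: norm_mult norm_power intro!: mult_mono)
  qed
  ultimately have "r \<longlonglongrightarrow> 0" by (intro Lim_null_comparison[of r]) auto
  hence "(\<lambda>K. qpoch_inf q q * (rank_gf q a - r K)) \<longlonglongrightarrow> qpoch_inf q q * (rank_gf q a - 0)"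
    by (intro tendsto_intros)
  moreover have "qpoch_inf q q * (rank_gf q a - r K) = (\<Sum>n<K. (-1) ^ n * q ^ (n * (3 * n + 2 * a + 3) div 2))" for K
    using rank_gf_partial[OF assms, of a K] qpoch_inf_nonzero[OF assms] by (simp add: r_def field_simps)
  ultimately show ?thesis by (simp add: sums_def)
qed

section \<open>Pairs of subsets\<close>

text \<open>The coefficient of \<open>z^k\<close> in the product of
  \<open>(1 + z q^i) (1 + q^i / z)\<close> over \<open>1 \<le> i \<le> N\<close>.\<close>

definition pair_sum :: "complex \<Rightarrow> nat \<Rightarrow> int \<Rightarrow> complex" where
  "pair_sum q N k = (\<Sum>A\<in>Pow {1..N}. \<Sum>B\<in>Pow {1..N}.
     if int (card B) - int (card A) = k then q ^ (\<Sum>A + \<Sum>B) else 0)"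

lemma sum_Pow_atLeastAtMost_Suc:
  fixes f :: "nat set \<Rightarrow> 'a :: comm_monoid_add"
  shows "(\<Sum>A\<in>Pow {1..Suc N}. f A) = (\<Sum>A\<in>Pow {1..N}. f A) + (\<Sum>A\<in>Pow {1..N}. f (insert (Suc N) A))"
proof -
  have inj: "inj_on (insert (Suc N)) (Pow {1..N})"
  proof (rule inj_on_inverseI)
    show "insert (Suc N) A - {Suc N} = A" if "A \<in> Pow {1..N}" for A
      using that by auto
  qed
  have "{1..Suc N} = insert (Suc N) {1..N}" by auto
  hence "Pow {1..Suc N} = Pow {1..N} \<union> insert (Suc N) ` Pow {1..N}"
    by (simp only: Pow_insert)
  moreover have "Pow {1..N} \<inter> insert (Suc N) ` Pow {1..N} = {}" by auto
  ultimately show ?thesis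
    by (simp only: sum.union_disjoint finite_Pow_iff finite_atLeastAtMost finite_imageI sum.reindex[OF inj] o_def)
qed

text \<open>Whether \<open>Suc N\<close> lies in neither set, in one or in both gives four cases;
  this is multiplication by \<open>(1 + z q^(N+1)) (1 + q^(N+1) / z)\<close>.\<close>

lemma pair_sum_Suc:
  "pair_sum q (Suc N) k = (1 + q ^ (2 * N + 2)) * pair_sum q N k +
     q ^ Suc N * (pair_sum q N (k - 1) + pair_sum q N (k + 1))"
proof -
  define f where "f A B k = (if int (card B) - int (card A) = k then q ^ (\<Sum>A + \<Sum>B) else 0)"
    for A B :: "nat set" and k
  have ps: "pair_sum q N k = (\<Sum>A\<in>Pow {1..N}. \<Sum>B\<in>Pow {1..N}. f A B k)" for N k
    by (simp add: pair_sum_def f_def)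
  define P where "P = Pow {1..N}"
  have c: "card (insert (Suc N) A) = Suc (card A)" "\<Sum>(insert (Suc N) A) = Suc N + \<Sum>A"
    if "A \<in> P" for A
  proof -
    have "finite A" "Suc N \<notin> A" using that by (auto simp: P_def finite_subset)
    thus "card (insert (Suc N) A) = Suc (card A)" "\<Sum>(insert (Suc N) A) = Suc N + \<Sum>A"
      by auto
  qed
  have f: "f (insert (Suc N) A) B k = q ^ Suc N * f A B (k + 1)"
          "f A (insert (Suc N) B) k = q ^ Suc N * f A B (k - 1)"
          "f (insert (Suc N) A) (insert (Suc N) B) k = q ^ (2 * N + 2) * f A B k"
    if "A \<in> P" "B \<in> P" for A B
    using that by (auto simp: f_def c power_add mult_2)
  have "pair_sum q (Suc N) k =
     (\<Sum>A\<in>P. (\<Sum>B\<in>P. f A B k)) + (\<Sum>A\<in>P. (\<Sum>B\<in>P. f A (insert (Suc N) B) k)) +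
     ((\<Sum>A\<in>P. (\<Sum>B\<in>P. f (insert (Suc N) A) B k)) +
      (\<Sum>A\<in>P. (\<Sum>B\<in>P. f (insert (Suc N) A) (insert (Suc N) B) k)))"
    unfolding ps sum_Pow_atLeastAtMost_Suc sum.distrib P_def by simp
  also have "\<dots> = (1 + q ^ (2 * N + 2)) * pair_sum q N k +
     q ^ Suc N * (pair_sum q N (k - 1) + pair_sum q N (k + 1))"
    unfolding ps P_def[symmetric]
    by (simp only: f sum_distrib_left[symmetric] cong: sum.cong) (simp add: algebra_simps)
  finally show ?thesis .
qed

lemma pair_sum_minus: "pair_sum q N (- k) = pair_sum q N k"
  unfolding pair_sum_def by (subst sum.swap) (auto simp: add.commute intro!: sum.cong)

lemma pair_sum_eq_0:
  assumes "k > int N"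
  shows "pair_sum q N k = 0"
proof -
  have "int (card B) - int (card A) \<noteq> k" if "B \<in> Pow {1..N}" for A B :: "nat set"
    using card_mono[of "{1..N}" B] that assms by auto
  thus ?thesis unfolding pair_sum_def by (intro sum.neutral ballI) simp
qed

text \<open>Three Pascal steps produce the shape of \<open>pair_sum_Suc\<close>, as the induction in
  \<open>pair_sum_add\<close> requires. The case \<open>t = 0\<close> is split off because
  \<open>t - 1\<close> would truncate to 0.\<close>

lemma gauss_pascal_double:
  assumes "norm q < 1"
  shows "gauss q (Suc t) (s + 2) = (1 + q ^ (t + s + 2)) * gauss q t (Suc s) +
           q ^ Suc t * gauss q (Suc t) s + (if t = 0 then 0 else q ^ (s + 2) * gauss q (t - 1) (s + 2))"
proof -
  have "gauss q (Suc t) (s + 2) = gauss q t (s + 2) + q ^ Suc t * gauss q (Suc t) (Suc s)"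
    using gauss_pascal1[OF assms, of t "Suc s"] by simp
  also have "gauss q (Suc t) (Suc s) = gauss q (Suc t) s + q ^ Suc s * gauss q t (Suc s)"
    by (rule gauss_pascal2[OF assms])
  also have "gauss q t (s + 2) = gauss q t (Suc s) +
      (if t = 0 then 0 else q ^ (s + 2) * gauss q (t - 1) (s + 2))"
    using gauss_pascal2[OF assms, of "t - 1" "Suc s"] assms by (cases t) simp_all
  finally show ?thesis by (simp add: algebra_simps power_add)
qed

lemma triangular_Suc: "Suc j * j div 2 = j * (j - 1) div 2 + j"
proof (cases j)
  case (Suc i)
  have "Suc (Suc i) * Suc i = Suc i * i + Suc i * 2" by simp
  thus ?thesis using Suc by (metis diff_Suc_1 div_mult_self3 zero_neq_numeral add.commute)
qed simp

text \<open>
  The finite Jacobi triple product for \<open>(1 + 1/z) \<Prod>\<^sub>i (1 + zq\<^sup>i) (1 + q\<^sup>i/z)\<close>, read off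
  coefficientwise in \<open>z\<close>.
\<close>
lemma pair_sum_add:
  assumes "norm q < 1"
  shows "pair_sum q N (int k - 1) + pair_sum q N (int k) =
           (if k \<le> N + 1 then q ^ (k * (k - 1) div 2) * gauss q (N + 1 - k) (N + k) else 0)"
proof (induction N arbitrary: k)
  case 0
  have "pair_sum q 0 l = (if l = 0 then 1 else 0)" for l
    by (simp add: pair_sum_def)
  thus ?case using assms by (cases k) auto
next
  case (Suc N)
  \<comment> \<open>This is the case \<open>k = j + 1\<close>, where the recursion only calls on the
    induction hypothesis at \<open>j\<close>, \<open>j + 1\<close> and \<open>j + 2\<close>. At
    \<open>k = 0\<close> it would reach a negative index.\<close>
  have pos: "pair_sum q (Suc N) (int j) + pair_sum q (Suc N) (int j + 1) =
      (if j \<le> N + 1 then q ^ (Suc j * j div 2) * gauss q (N + 1 - j) (N + j + 2) else 0)" for j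
  proof -
    have IH0: "pair_sum q N (int j - 1) + pair_sum q N (int j) =
        (if j \<le> N + 1 then q ^ (j * (j - 1) div 2) * gauss q (N + 1 - j) (N + j) else 0)"
      by (rule Suc.IH)
    have IH1: "pair_sum q N (int j) + pair_sum q N (int j + 1) =
        (if j \<le> N then q ^ (Suc j * j div 2) * gauss q (N - j) (N + j + 1) else 0)"
      using Suc.IH[of "Suc j"] by (simp add: add.commute)
    have IH2: "pair_sum q N (int j + 1) + pair_sum q N (int j + 2) =
        (if j < N then q ^ (Suc (Suc j) * Suc j div 2) * gauss q (N - 1 - j) (N + j + 2) else 0)"
      using Suc.IH[of "Suc (Suc j)"] by (simp add: add.commute Suc_le_eq)
    have "pair_sum q (Suc N) (int j) + pair_sum q (Suc N) (int j + 1) =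
        (1 + q ^ (2 * N + 2)) * (pair_sum q N (int j) + pair_sum q N (int j + 1)) +
        q ^ Suc N * ((pair_sum q N (int j - 1) + pair_sum q N (int j)) +
                     (pair_sum q N (int j + 1) + pair_sum q N (int j + 2)))"
      unfolding pair_sum_Suc by (simp add: algebra_simps)
    also have "\<dots> = (if j \<le> N + 1 then q ^ (Suc j * j div 2) * gauss q (N + 1 - j) (N + j + 2) else 0)"
    proof (cases "j \<le> N")
      case True
      define t where "t = N - j"
      have N: "N = j + t" using True by (simp add: t_def)
      \<comment> \<open>\<open>E\<close> is the power of \<open>q\<close> common to all terms; once
        it is factored out, \<open>gauss_pascal_double\<close> with \<open>s = N + j\<close>
        remains.\<close>
      define E where "E = q ^ (Suc j * j div 2)"
      have e: "q ^ Suc N * q ^ (Suc (Suc j) * Suc j div 2) = E * q ^ (N + j + 2)"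
              "q ^ Suc N * q ^ (j * (j - 1) div 2) = E * q ^ Suc t"
        unfolding E_def power_add[symmetric]
        using triangular_Suc[of "Suc j"] triangular_Suc[of j] N
        by (intro arg_cong[of _ _ "power q"]; simp)+
      have g: "gauss q (Suc t) (N + j + 2) = (1 + q ^ (t + (N + j) + 2)) * gauss q t (Suc (N + j)) +
           q ^ Suc t * gauss q (Suc t) (N + j) +
           (if t = 0 then 0 else q ^ (N + j + 2) * gauss q (t - 1) (N + j + 2))"
        by (rule gauss_pascal_double[OF assms])
      have n: "N + 1 - j = Suc t" "N - j = t" "N - 1 - j = t - 1" "j < N \<longleftrightarrow> t \<noteq> 0"
          "t + (N + j) + 2 = 2 * N + 2" "j \<le> N + 1" "j \<le> N" "N + j + 1 = Suc (N + j)"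
        using N by auto
      have "(1 + W) * (E * G) + Q * (F * G' + (if t \<noteq> 0 then H * G'' else 0)) =
          E * ((1 + W) * G + X * G' + (if t = 0 then 0 else Y * G''))"
        if "Q * H = E * Y" "Q * F = E * X" for W G Q F G' H G'' X Y :: complex
      proof -
        have "Q * (F * G' + (if t \<noteq> 0 then H * G'' else 0)) =
            (Q * F) * G' + (if t \<noteq> 0 then (Q * H) * G'' else 0)"
          by (simp add: algebra_simps)
        thus ?thesis unfolding that by (simp add: algebra_simps)
      qed
      note split = this[OF e]
      show ?thesis
        by (simp only: IH0 IH1 IH2 n g[unfolded n] E_def[symmetric] if_True split)
    next
      \<comment> \<open>For \<open>j = N + 1\<close> only the first hypothesis contributes, with
        Gaussian binomial 1; beyond that every term is 0.\<close>
      case False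
      thus ?thesis unfolding IH0 IH1 IH2 using assms triangular_Suc[of j]
        by (auto simp: power_add le_Suc_eq mult.commute)
    qed
    finally show ?thesis .
  qed
  show ?case
  proof (cases k)
    case 0
    \<comment> \<open>Reflection carries \<open>k = 0\<close> to the already proved
      \<open>k = 1\<close>, and the Gaussian binomial is symmetric.\<close>
    have "pair_sum q (Suc N) (-1) = pair_sum q (Suc N) 1" using pair_sum_minus[of q "Suc N" 1] by simp
    thus ?thesis using pos[of 0] 0 by (simp add: gauss_commute add.commute)
  next
    case (Suc j)
    thus ?thesis using pos[of j] by (simp add: add.commute)
  qed
qed

text \<open>Solve \<open>pair_sum_add\<close> for its lower coefficient and repeat from
  \<open>m\<close> upwards. After \<open>d + 1\<close> steps the index exceeds
  \<open>N = m + d\<close>, where the coefficient is 0.\<close>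

lemma pair_sum_eq:
  assumes "norm q < 1"
  shows "pair_sum q (m + d) (int m) =
           (\<Sum>i\<le>d. (-1) ^ i * q ^ ((m + i) * (m + i + 1) div 2) * gauss q (d - i) (d + 2 * m + i + 1))"
proof -
  have "pair_sum q (m + d) (int m) =
      (\<Sum>i<l. (-1) ^ i * q ^ ((m + i) * (m + i + 1) div 2) * gauss q (d - i) (d + 2 * m + i + 1)) +
      (-1) ^ l * pair_sum q (m + d) (int (m + l))" if "l \<le> Suc d" for l
    using that
  proof (induction l)
    case (Suc l)
    have eq: "pair_sum q (m + d) (int (m + l)) =
       q ^ ((m + l) * (m + l + 1) div 2) * gauss q (d - l) (d + 2 * m + l + 1) - pair_sum q (m + d) (int (m + Suc l))"
    proof -
      have "m + d + 1 - Suc (m + l) = d - l" "m + d + Suc (m + l) = d + 2 * m + l + 1"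
        "Suc (m + l) * (Suc (m + l) - 1) = (m + l) * (m + l + 1)" "Suc (m + l) \<le> m + d + 1"
        using Suc.prems by auto
      hence "pair_sum q (m + d) (int (Suc (m + l)) - 1) + pair_sum q (m + d) (int (Suc (m + l))) =
          q ^ ((m + l) * (m + l + 1) div 2) * gauss q (d - l) (d + 2 * m + l + 1)"
        using pair_sum_add[OF assms, of "m + d" "Suc (m + l)"] by (simp only: if_True)
      thus ?thesis by (simp add: eq_diff_eq)
    qed
    show ?case
      unfolding Suc.IH[OF Suc_leD[OF Suc.prems]] eq sum.lessThan_Suc by (simp add: right_diff_distrib)
  qed simp
  from this[of "Suc d"] show ?thesis
    by (simp add: pair_sum_eq_0 lessThan_Suc_atMost)
qed

section \<open>Strongly unimodal sequences as pairs of subsets\<close>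

lemma is_peak_iff:
  "is_peak a k \<longleftrightarrow> (\<exists>l p r. a = l @ p # r \<and> k = Suc (length l) \<and>
     sorted_wrt (<) (l @ [p]) \<and> sorted_wrt (>) (p # r))"
proof
  assume *: "is_peak a k"
  hence "k - 1 < length a" "k > 0" by (auto simp: is_peak_def)
  hence "a = take (k - 1) a @ a ! (k - 1) # drop k a" "take k a = take (k - 1) a @ [a ! (k - 1)]"
    "drop (k - 1) a = a ! (k - 1) # drop k a"
    using id_take_nth_drop[of "k - 1" a] take_Suc_conv_app_nth[of "k - 1" a] Cons_nth_drop_Suc[of "k - 1" a]
    by auto
  moreover have "k = Suc (length (take (k - 1) a))" using \<open>k - 1 < length a\<close> \<open>k > 0\<close> by simp
  ultimately show "\<exists>l p r. a = l @ p # r \<and> k = Suc (length l) \<and>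
     sorted_wrt (<) (l @ [p]) \<and> sorted_wrt (>) (p # r)"
    using * unfolding is_peak_def by metis
qed (auto simp: is_peak_def)

text \<open>For two peaks \<open>k < k'\<close>, the entries at positions \<open>k\<close> and
  \<open>k + 1\<close> lie both in the increasing prefix of \<open>k'\<close> and in the decreasing
  suffix of \<open>k\<close>.\<close>

lemma is_peak_unique:
  assumes "is_peak a k" "is_peak a k'"
  shows "k = k'"
proof -
  have False if "is_peak a k" "is_peak a k'" "k < k'" for k k'
  proof -
    from that have k: "0 < k" "k' \<le> length a" by (auto simp: is_peak_def)
    have "sorted_wrt (<) (take k' a)" using that by (simp add: is_peak_def)
    hence "take k' a ! (k - 1) < take k' a ! k"
      using k that sorted_wrt_nth_less[of "(<)" "take k' a" "k - 1" k] by auto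
    moreover have "sorted_wrt (>) (drop (k - 1) a)" using that by (simp add: is_peak_def)
    hence "drop (k - 1) a ! 0 > drop (k - 1) a ! 1"
      using k that sorted_wrt_nth_less[of "(>)" "drop (k - 1) a" 0 1] by auto
    ultimately show False using k that by simp
  qed
  thus ?thesis using assms by (metis linorder_neqE_nat)
qed

lemma unimodal_rank_append:
  assumes "sorted_wrt (<) (l @ [p])" "sorted_wrt (>) (p # r)"
  shows "unimodal_rank (l @ p # r) = int (length r) - int (length l)"
proof -
  have "is_peak (l @ p # r) (Suc (length l))" using assms is_peak_iff by blast
  hence "(THE k. is_peak (l @ p # r) k) = Suc (length l)"
    using is_peak_unique by (intro the_equality) auto
  thus ?thesis by (simp add: unimodal_rank_def)
qed

lemma strongly_unimodal_iff:
  "strongly_unimodal a \<longleftrightarrow> (\<exists>l p r. a = l @ p # r \<and> (\<forall>x\<in>set a. 0 < x) \<and>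
     sorted_wrt (<) (l @ [p]) \<and> sorted_wrt (>) (p # r))"
  unfolding strongly_unimodal_def is_peak_iff by blast

text \<open>Taking the peak to be \<open>Suc N\<close> makes every natural \<open>N\<close>
  admissible, the empty range \<open>{1..0}\<close> giving the one-term sequence.\<close>

definition unimodal_of_sets :: "nat \<times> nat set \<times> nat set \<Rightarrow> nat list" where
  "unimodal_of_sets = (\<lambda>(N, A, B). sorted_list_of_set A @ Suc N # rev (sorted_list_of_set B))"

lemma sorted_wrt_greater_rev: "sorted_wrt (>) (rev xs) \<longleftrightarrow> sorted_wrt (<) (xs :: 'a :: linorder list)"
  by (simp add: sorted_wrt_rev)

lemma sorted_list_of_set_set_eq:
  assumes "sorted_wrt (<) (xs :: nat list)"
  shows "sorted_list_of_set (set xs) = xs"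
  using assms by (simp add: sorted_list_of_set.idem_if_sorted_distinct strict_sorted_iff)

lemma unimodal_of_sets_sorted:
  assumes "A \<subseteq> {1..N}" "B \<subseteq> {1..N}"
  shows "sorted_wrt (<) (sorted_list_of_set A @ [Suc N])"
        "sorted_wrt (>) (Suc N # rev (sorted_list_of_set B))"
proof -
  have "finite A" "finite B" using assms finite_subset by auto
  thus "sorted_wrt (<) (sorted_list_of_set A @ [Suc N])"
       "sorted_wrt (>) (Suc N # rev (sorted_list_of_set B))"
    using assms by (auto simp: sorted_wrt_append sorted_wrt_greater_rev less_Suc_eq_le)
qed

lemma is_peak_unimodal_of_sets:
  assumes "A \<subseteq> {1..N}" "B \<subseteq> {1..N}"
  shows "is_peak (unimodal_of_sets (N, A, B)) (Suc (length (sorted_list_of_set A)))"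
  unfolding is_peak_iff unimodal_of_sets_def prod.case
  using unimodal_of_sets_sorted[OF assms] by (intro exI conjI) (rule refl | assumption)+

lemma bij_betw_unimodal_of_sets:
  "bij_betw unimodal_of_sets (SIGMA N:UNIV. Pow {1..N} \<times> Pow {1..N}) {a. strongly_unimodal a}"
proof (rule bij_betw_imageI)
  show "inj_on unimodal_of_sets (SIGMA N:UNIV. Pow {1..N} \<times> Pow {1..N})"
  proof (rule inj_onI)
    fix y y' :: "nat \<times> nat set \<times> nat set"
    assume mem: "y \<in> (SIGMA N:UNIV. Pow {1..N} \<times> Pow {1..N})" "y' \<in> (SIGMA N:UNIV. Pow {1..N} \<times> Pow {1..N})"
    obtain N A B N' A' B' where y: "y = (N, A, B)" "y' = (N', A', B')" by (cases y, cases y')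
    have sub: "A \<subseteq> {1..N}" "B \<subseteq> {1..N}" "A' \<subseteq> {1..N'}" "B' \<subseteq> {1..N'}"
      using mem unfolding y by simp_all
    assume "unimodal_of_sets y = unimodal_of_sets y'"
    hence eq: "unimodal_of_sets (N, A, B) = unimodal_of_sets (N', A', B')" unfolding y .
    have fin: "finite A" "finite B" "finite A'" "finite B'" using sub by (blast intro: finite_subset finite_atLeastAtMost)+
    \<comment> \<open>Equal lists have the same unique peak, so both are cut at the same
      position.\<close>
    have "length (sorted_list_of_set A) = length (sorted_list_of_set A')"
      using is_peak_unique[of "unimodal_of_sets (N, A, B)"]
        is_peak_unimodal_of_sets[OF sub(1,2)] is_peak_unimodal_of_sets[OF sub(3,4), folded eq]
      by (metis Suc_inject)
    with eq have "sorted_list_of_set A = sorted_list_of_set A'" "N = N'"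
      "sorted_list_of_set B = sorted_list_of_set B'"
      unfolding unimodal_of_sets_def prod.case by (simp_all add: append_eq_append_conv)
    thus "y = y'"
      unfolding y using fin by (metis set_sorted_list_of_set)
  qed
  show "unimodal_of_sets ` (SIGMA N:UNIV. Pow {1..N} \<times> Pow {1..N}) = {a. strongly_unimodal a}"
  proof (intro equalityI subsetI; clarify)
    fix N :: nat and A B assume sub: "A \<subseteq> {1..N}" "B \<subseteq> {1..N}"
    hence "\<forall>x\<in>set (unimodal_of_sets (N, A, B)). 0 < x"
      using finite_subset[OF sub(1)] finite_subset[OF sub(2)] by (auto simp: unimodal_of_sets_def)
    with is_peak_unimodal_of_sets[OF sub] show "strongly_unimodal (unimodal_of_sets (N, A, B))"
      unfolding strongly_unimodal_def by blast
  next
    fix a assume "strongly_unimodal a"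
    then obtain l p r where a: "a = l @ p # r" "\<forall>x\<in>set a. 0 < x"
      "sorted_wrt (<) (l @ [p])" "sorted_wrt (>) (p # r)"
      unfolding strongly_unimodal_iff by blast
    have "sorted_list_of_set (set l) = l"
      using a by (intro sorted_list_of_set_set_eq) (simp add: sorted_wrt_append)
    moreover have "sorted_list_of_set (set (rev r)) = rev r"
      using a sorted_wrt_greater_rev[of "rev r"] by (intro sorted_list_of_set_set_eq) simp
    ultimately have eq: "a = unimodal_of_sets (p - 1, set l, set r)"
      using a by (simp add: unimodal_of_sets_def)
    have "x \<in> {1..p - 1}" if "x \<in> set l \<union> set r" for x
    proof -
      have "0 < x" "x < p" using a that by (auto simp: sorted_wrt_append)
      thus ?thesis by auto
    qed
    hence "(p - 1, set l, set r) \<in> (SIGMA N:UNIV. Pow {1..N} \<times> Pow {1..N})" by blast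
    thus "a \<in> unimodal_of_sets ` (SIGMA N:UNIV. Pow {1..N} \<times> Pow {1..N})"
      unfolding eq by (rule imageI)
  qed
qed

lemma sum_list_unimodal_of_sets:
  assumes "A \<subseteq> {1..N}" "B \<subseteq> {1..N}"
  shows "sum_list (unimodal_of_sets (N, A, B)) = Suc N + (\<Sum>A + \<Sum>B)"
proof -
  have "finite A" "finite B" using assms finite_subset by auto
  thus ?thesis
    by (simp add: unimodal_of_sets_def distinct_sum_list_conv_Sum)
qed

lemma unimodal_rank_unimodal_of_sets:
  assumes "A \<subseteq> {1..N}" "B \<subseteq> {1..N}"
  shows "unimodal_rank (unimodal_of_sets (N, A, B)) = int (card B) - int (card A)"
  using unimodal_rank_append[OF unimodal_of_sets_sorted[OF assms]] by (simp add: unimodal_of_sets_def)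

section \<open>Absolute convergence and two groupings of the sum over sequences\<close>

lemma length_le_sum_list:
  assumes "\<forall>x\<in>set xs. 0 < (x :: nat)"
  shows "length xs \<le> sum_list xs"
  using assms by (induction xs) (auto simp: Suc_le_eq intro: add_less_le_mono)

lemma finite_strongly_unimodal: "finite {a. strongly_unimodal a \<and> sum_list a = n}"
proof (rule finite_subset)
  show "{a. strongly_unimodal a \<and> sum_list a = n} \<subseteq> {a. set a \<subseteq> {..n} \<and> length a \<le> n}"
    using length_le_sum_list member_le_sum_list by (auto simp: strongly_unimodal_def)
qed (simp add: finite_lists_length_le)

text \<open>For fixed \<open>N\<close> the sum of absolute values factors as
  \<open>x ^ Suc N * (W N * W N)\<close>. As \<open>W N\<close> is bounded uniformly, a geometric
  series in \<open>N\<close> dominates.\<close>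

lemma summable_strongly_unimodal:
  fixes q :: complex
  assumes "norm q < 1"
  shows "(\<lambda>a. q ^ sum_list a) summable_on {a. strongly_unimodal a}"
proof -
  define x where "x = norm q"
  have x: "0 \<le> x" "x < 1" using assms by (auto simp: x_def)
  define W where "W N = (\<Sum>A\<in>Pow {1..N}. x ^ \<Sum>A)" for N
  have "W N \<le> exp (1 / (1 - x))" for N
  proof -
    \<comment> \<open>Expanding the product over subsets identifies \<open>W N\<close>, which is
      then bounded through \<open>1 + y \<le> exp y\<close>.\<close>
    have "(\<Prod>i\<in>{1..N}. x ^ i + 1) = (\<Sum>A\<in>Pow {1..N}. \<Prod>i\<in>A. x ^ i)"
      by (subst prod_add) auto
    hence "W N = (\<Prod>i\<in>{1..N}. 1 + x ^ i)"
      by (simp add: W_def power_sum add.commute)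
    also have "\<dots> \<le> exp (\<Sum>i\<in>{1..N}. x ^ i)" using x by (intro prod_le_exp_sum) auto
    also have "(\<Sum>i\<in>{1..N}. x ^ i) \<le> 1 / (1 - x)"
      using sum_le_suminf[of "\<lambda>i. x ^ i" "{1..N}"] x by (simp add: summable_geometric suminf_geometric)
    finally show ?thesis by simp
  qed
  then obtain C where C: "\<And>N. W N \<le> C" by blast
  have W0: "W N \<ge> 0" for N using x by (auto simp: W_def intro!: sum_nonneg)
  define f where "f = (\<lambda>(N, A, B). x ^ (Suc N + (\<Sum>A + \<Sum>B)))"
  have f: "f summable_on (SIGMA N:UNIV. Pow {1..N} \<times> Pow {1..N})"
  proof (rule summable_on_SigmaI)
    fix N :: nat
    show "((\<lambda>y. f (N, y)) has_sum (x ^ Suc N * (W N * W N))) (Pow {1..N} \<times> Pow {1..N})"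
    proof (rule has_sum_finiteI)
      show "x ^ Suc N * (W N * W N) = (\<Sum>y\<in>Pow {1..N} \<times> Pow {1..N}. f (N, y))"
      proof -
        have "W N * W N = (\<Sum>(A, B)\<in>Pow {1..N} \<times> Pow {1..N}. x ^ \<Sum>A * x ^ \<Sum>B)"
          unfolding W_def sum_product sum.cartesian_product ..
        thus ?thesis
          by (simp only: sum_distrib_left f_def prod.case power_add case_prod_unfold fst_conv snd_conv)
      qed
    qed simp
  next
    show "(\<lambda>N. x ^ Suc N * (W N * W N)) summable_on UNIV"
    proof (rule summable_on_comparison_test)
      show "(\<lambda>N. x ^ N * (C * C)) summable_on UNIV"
        using x by (intro norm_summable_imp_summable_on) (simp add: abs_mult power_abs summable_mult2 summable_geometric)
      show "x ^ Suc N * (W N * W N) \<le> x ^ N * (C * C)" for N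
        using C[of N] W0[of N] x by (intro mult_mono power_decreasing) auto
    qed (use x W0 in auto)
  qed (use x in \<open>auto simp: f_def\<close>)
  have f_eq: "f y = norm (q ^ sum_list (unimodal_of_sets y))"
    if "y \<in> (SIGMA N:UNIV. Pow {1..N} \<times> Pow {1..N})" for y
    using that by (auto simp: f_def sum_list_unimodal_of_sets norm_power norm_mult x_def)
  have "(\<lambda>y. norm (q ^ sum_list (unimodal_of_sets y))) summable_on (SIGMA N:UNIV. Pow {1..N} \<times> Pow {1..N})"
    by (rule iffD1[OF summable_on_cong[OF f_eq] f])
  hence "(\<lambda>a. norm (q ^ sum_list a)) summable_on {a. strongly_unimodal a}"
    using summable_on_reindex_bij_betw[OF bij_betw_unimodal_of_sets, of "\<lambda>a. norm (q ^ sum_list a)"] by blast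
  thus ?thesis by (rule abs_summable_summable)
qed

text \<open>Both series regroup the same absolutely convergent sum over sequences of rank
  \<open>m\<close>: the first by size, the second by peak \<open>Suc N\<close>.\<close>

lemma has_sum_unimodal:
  assumes "norm q < 1"
  obtains S where "((\<lambda>n. of_nat (u m n) * q ^ n) has_sum S) {1..}"
    and "((\<lambda>N. q ^ Suc N * pair_sum q N m) has_sum S) UNIV"
proof -
  define X where "X = {a. strongly_unimodal a \<and> unimodal_rank a = m}"
  have "(\<lambda>a. q ^ sum_list a) summable_on X"
    using summable_strongly_unimodal[OF assms] by (rule summable_on_subset_banach) (auto simp: X_def)
  then obtain S where S: "((\<lambda>a. q ^ sum_list a) has_sum S) X" by (auto simp: summable_on_def)
  define Y where "Y n = {a. strongly_unimodal a \<and> sum_list a = n \<and> unimodal_rank a = m}" for n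
  have "((\<lambda>(n, a). q ^ n) has_sum S) (Sigma {1..} Y)"
  proof (rule iffD1[OF has_sum_reindex_bij_witness[where i = snd and j = "\<lambda>a. (sum_list a, a)"] S])
    \<comment> \<open>The peak is positive, so no sequence has size 0.\<close>
    fix a assume "a \<in> X"
    then show "(sum_list a, a) \<in> Sigma {1..} Y"
      by (auto simp: X_def Y_def strongly_unimodal_iff Suc_le_eq)
  qed (auto simp: X_def Y_def)
  hence "((\<lambda>n. of_nat (u m n) * q ^ n) has_sum S) {1..}"
  proof (rule has_sum_SigmaD)
    fix n :: nat
    have "finite (Y n)" by (rule finite_subset[OF _ finite_strongly_unimodal[of n]]) (auto simp: Y_def)
    thus "((\<lambda>y. case (n, y) of (n, a) \<Rightarrow> q ^ n) has_sum of_nat (u m n) * q ^ n) (Y n)"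
      by (intro has_sum_finiteI) (auto simp: Y_def u_def)
  qed
  moreover have "((\<lambda>N. q ^ Suc N * pair_sum q N m) has_sum S) UNIV"
  proof (rule has_sum_SigmaD)
    define Z where "Z N = {(A, B) \<in> Pow {1..N} \<times> Pow {1..N}. int (card B) - int (card A) = m}" for N :: nat
    define f where "f = (\<lambda>(N, A, B). q ^ (Suc N + (\<Sum>A + \<Sum>B)))"
    have bij: "bij_betw unimodal_of_sets (Sigma UNIV Z) X"
    proof (rule bij_betw_subset[OF bij_betw_unimodal_of_sets])
      have "X = {a \<in> unimodal_of_sets ` (SIGMA N:UNIV. Pow {1..N} \<times> Pow {1..N}). unimodal_rank a = m}"
        unfolding bij_betw_imp_surj_on[OF bij_betw_unimodal_of_sets] X_def by simp
      also have "\<dots> = unimodal_of_sets `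
          {y \<in> (SIGMA N:UNIV. Pow {1..N} \<times> Pow {1..N}). unimodal_rank (unimodal_of_sets y) = m}"
        by blast
      also have "{y \<in> (SIGMA N:UNIV. Pow {1..N} \<times> Pow {1..N}). unimodal_rank (unimodal_of_sets y) = m}
          = Sigma UNIV Z"
      proof (intro set_eqI, clarify)
        fix N A B
        show "(N, A, B) \<in> {y \<in> (SIGMA N:UNIV. Pow {1..N} \<times> Pow {1..N}).
            unimodal_rank (unimodal_of_sets y) = m} \<longleftrightarrow> (N, A, B) \<in> Sigma UNIV Z"
          using unimodal_rank_unimodal_of_sets[of A N B] unfolding Z_def by auto
      qed
      finally show "unimodal_of_sets ` Sigma UNIV Z = X" ..
    qed (unfold Z_def, blast)
    have "((\<lambda>y. q ^ sum_list (unimodal_of_sets y)) has_sum S) (Sigma UNIV Z)"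
      by (rule iffD2[OF has_sum_reindex_bij_betw[OF bij] S])
    moreover have "q ^ sum_list (unimodal_of_sets y) = f y" if "y \<in> Sigma UNIV Z" for y
    proof -
      obtain N A B where "y = (N, A, B)" by (cases y)
      thus ?thesis using that sum_list_unimodal_of_sets[of A N B] unfolding Z_def f_def by auto
    qed
    ultimately show "(f has_sum S) (Sigma UNIV Z)"
      by (rule iffD1[OF has_sum_cong, rotated])
    fix N
    have "Z N \<subseteq> Pow {1..N} \<times> Pow {1..N}" by (auto simp: Z_def)
    hence "finite (Z N)" by (rule finite_subset) simp
    moreover have "q ^ Suc N * pair_sum q N m = (\<Sum>y\<in>Z N. f (N, y))"
    proof -
      have Z: "Z N = {y \<in> Pow {1..N} \<times> Pow {1..N}. int (card (snd y)) - int (card (fst y)) = m}"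
        by (auto simp: Z_def)
      have "pair_sum q N m = (\<Sum>y\<in>Z N. q ^ (\<Sum>(fst y) + \<Sum>(snd y)))"
        unfolding pair_sum_def sum.cartesian_product Z
        by (subst sum.inter_filter) (simp_all add: case_prod_unfold)
      thus ?thesis
        by (simp only: f_def sum_distrib_left power_add[of q "Suc N"] case_prod_unfold fst_conv snd_conv)
    qed
    ultimately show "((\<lambda>y. f (N, y)) has_sum q ^ Suc N * pair_sum q N m) (Z N)"
      by (intro has_sum_finiteI)
  qed
  ultimately show ?thesis by (rule that)
qed

section \<open>Coefficients near the lowest order\<close>

lemma strict_sorted_nth_ge:
  assumes "sorted_wrt (<) (xs :: nat list)" "i \<le> j" "j < length xs"
  shows "xs ! i + (j - i) \<le> xs ! j"
  using assms(2,3)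
proof (induction j rule: dec_induct)
  case (step j)
  have "xs ! j < xs ! Suc j" using step assms(1) by (simp add: sorted_wrt_nth_less)
  thus ?case using step by simp
qed simp

lemma strict_sorted_positive_nth_ge:
  assumes "sorted_wrt (<) (xs :: nat list)" "\<forall>x\<in>set xs. 0 < x" "i < length xs"
  shows "Suc i \<le> xs ! i"
proof -
  have "xs ! 0 \<in> set xs" using assms(3) by (intro nth_mem) auto
  thus ?thesis using strict_sorted_nth_ge[OF assms(1), of 0 i] assms(2,3) by fastforce
qed

lemma sum_Suc_lessThan: "(\<Sum>i<L. Suc i) = (L + 1) * L div 2"
  by (induction L) auto

text \<open>The entry at 0-based index \<open>i\<close> is at least \<open>i + 1\<close>, so the
  staircase is the smallest case.\<close>

lemma strict_sorted_sum_list_ge: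
  assumes "sorted_wrt (<) (xs :: nat list)" "\<forall>x\<in>set xs. 0 < x"
  shows "(length xs + 1) * length xs div 2 \<le> sum_list xs"
proof -
  have "(\<Sum>i<length xs. Suc i) \<le> (\<Sum>i<length xs. xs ! i)"
    using strict_sorted_positive_nth_ge[OF assms] by (intro sum_mono) auto
  thus ?thesis by (simp add: sum_Suc_lessThan sum_list_sum_nth atLeast0LessThan)
qed

text \<open>
  A nonempty left part forces at least \<open>m + 2\<close> distinct parts from the peak on, which already
  exceeds the size.
\<close>
lemma strongly_unimodal_small_size:
  assumes "n \<le> m + 1"
  shows "{a. strongly_unimodal a \<and> sum_list a = (m + 2) * (m + 1) div 2 + n \<and> unimodal_rank a = int m} =
         rev ` {xs. sorted_wrt (<) xs \<and> (\<forall>x\<in>set xs. 0 < x) \<and> length xs = m + 1 \<and>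
                   sum_list xs = (m + 2) * (m + 1) div 2 + n}" (is "?L = rev ` ?R")
proof (intro equalityI subsetI)
  fix a assume "a \<in> ?L"
  hence sum: "sum_list a = (m + 2) * (m + 1) div 2 + n" and rank: "unimodal_rank a = int m"
    and "strongly_unimodal a" by auto
  then obtain l p r where a: "a = l @ p # r" and pos: "\<forall>x\<in>set a. 0 < x"
    and s: "sorted_wrt (<) (l @ [p])" "sorted_wrt (>) (p # r)"
    unfolding strongly_unimodal_iff by blast
  have len: "length r = length l + m"
    using rank unimodal_rank_append[OF s] unfolding a by simp
  have sr: "sorted_wrt (<) (rev (p # r))" using s(2) sorted_wrt_greater_rev[of "rev (p # r)"] by simp
  have "l = []"
  proof (rule ccontr)
    assume "l \<noteq> []"
    hence "m + 2 \<le> length (p # r)" using len by (cases l) auto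
    hence "(m + 2 + 1) * (m + 2) div 2 \<le> (length (p # r) + 1) * length (p # r) div 2"
      by (intro div_le_mono mult_le_mono) auto
    also have "\<dots> \<le> sum_list (rev (p # r))"
      using strict_sorted_sum_list_ge[OF sr] pos a by simp
    also have "\<dots> \<le> sum_list a" by (simp add: a sum_list_rev)
    also have "\<dots> = (m + 2) * (m + 1) div 2 + n" by (fact sum)
    \<comment> \<open>The bound exceeds the base triangular number by \<open>m + 2\<close>, which is
      more than \<open>n\<close>.\<close>
    also have "(m + 2 + 1) * (m + 2) = (m + 2) * (m + 1) + 2 * (m + 2)" by (simp add: algebra_simps)
    finally show False using assms by simp
  qed
  hence "rev a \<in> ?R" using sr pos len sum by (simp add: a sum_list_rev)
  thus "a \<in> rev ` ?R" by (intro image_eqI[of a rev "rev a"]) auto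
next
  fix a assume "a \<in> rev ` ?R"
  then obtain xs where a: "a = rev xs" and xs: "xs \<in> ?R" by blast
  have len: "length a = m + 1" using xs a by simp
  then obtain p r where pr: "a = p # r" by (cases a) auto
  have s: "sorted_wrt (<) ([] @ [p])" "sorted_wrt (>) (p # r)"
    using xs sorted_wrt_greater_rev[of xs] unfolding pr[symmetric] a by simp_all
  have "length r = m" using len pr by simp
  hence "unimodal_rank a = int m" using unimodal_rank_append[OF s] pr by simp
  moreover have "a = [] @ p # r \<and> (\<forall>x\<in>set a. 0 < x)" using xs a pr by simp
  with s have "strongly_unimodal a" unfolding strongly_unimodal_iff by blast
  ultimately show "a \<in> ?L" using xs a by (simp add: sum_list_rev)
qed

text \<open>Subtracting the staircase \<open>1, ..., L\<close> entrywise turns strict increase into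
  weak increase, with zeros allowed.\<close>

lemma card_strict_sorted_eq:
  "card {xs. sorted_wrt (<) xs \<and> (\<forall>x\<in>set xs. 0 < x) \<and> length xs = L \<and> sum_list xs = (L + 1) * L div 2 + n} =
   card {ys :: nat list. sorted ys \<and> length ys = L \<and> sum_list ys = n}"
  (is "card ?X = card ?Y")
proof -
  define up where "up ys = map (\<lambda>i. ys ! i + Suc i) [0..<L]" for ys
  define down where "down xs = map (\<lambda>i. xs ! i - Suc i) [0..<L]" for xs
  have len: "length (up ys) = L" "length (down xs) = L" for xs ys by (auto simp: up_def down_def)
  have nth: "up ys ! i = ys ! i + Suc i" "down xs ! i = xs ! i - Suc i" if "i < L" for xs ys i
    using that by (auto simp: up_def down_def)
  have 1: "\<forall>ys\<in>?Y. down (up ys) = ys"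
    by (auto intro!: nth_equalityI simp: len nth)
  \<comment> \<open>This makes the truncated subtraction in \<open>down\<close> exact.\<close>
  have ge: "Suc i \<le> xs ! i" if "xs \<in> ?X" "i < L" for xs i
    using that strict_sorted_positive_nth_ge by simp
  have 2: "\<forall>xs\<in>?X. up (down xs) = xs"
    by (intro ballI nth_equalityI) (use ge in \<open>auto simp: len nth\<close>)
  have sum: "sum_list (up ys) = sum_list ys + (L + 1) * L div 2" if "length ys = L" for ys
  proof -
    have "sum_list (up ys) = (\<Sum>i<L. ys ! i + Suc i)"
      by (simp add: sum_list_sum_nth len nth atLeast0LessThan)
    also have "\<dots> = (\<Sum>i<L. ys ! i) + (L + 1) * L div 2"
      by (simp only: sum.distrib sum_Suc_lessThan)
    finally show ?thesis using that by (simp add: sum_list_sum_nth atLeast0LessThan)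
  qed
  have 3: "up ` ?Y \<subseteq> ?X"
  proof (intro image_subsetI)
    fix ys assume ys: "ys \<in> ?Y"
    have "sorted_wrt (<) (up ys)" unfolding sorted_wrt_iff_nth_less
      using ys by (auto simp: len nth intro!: add_le_less_mono sorted_nth_mono)
    moreover have "\<forall>x\<in>set (up ys). 0 < x" by (auto simp: up_def)
    ultimately show "up ys \<in> ?X" using ys len sum[of ys] by simp
  qed
  have 4: "down ` ?X \<subseteq> ?Y"
  proof (intro image_subsetI)
    fix xs assume xs: "xs \<in> ?X"
    have "sorted (down xs)" unfolding sorted_iff_nth_mono
    proof (intro allI impI)
      fix i j assume ij: "i \<le> j" "j < length (down xs)"
      \<comment> \<open>The gap of at least \<open>j - i\<close> absorbs the difference of the
        subtracted stairs.\<close>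
      hence "xs ! i + (j - i) \<le> xs ! j" using xs by (intro strict_sorted_nth_ge) (auto simp: len)
      thus "down xs ! i \<le> down xs ! j" using ij by (simp add: len nth)
    qed
    moreover have "sum_list (down xs) = n"
    proof -
      have "up (down xs) = xs"
        by (intro nth_equalityI) (use ge xs in \<open>auto simp: len nth\<close>)
      thus ?thesis using sum[of "down xs"] len xs by simp
    qed
    ultimately show "down xs \<in> ?Y" using len by simp
  qed
  show ?thesis
    by (rule bij_betw_same_card[OF bij_betw_byWitness[OF 1 2 3 4], symmetric])
qed

text \<open>Deleting zeros gives a partition, and padding with zeros inverts this: a partition of
  \<open>n\<close> has at most \<open>n \<le> L\<close> parts, so it fits into length
  \<open>L\<close>.\<close>

lemma card_sorted_eq_partition_count:
  assumes "n \<le> L"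
  shows "card {ys :: nat list. sorted ys \<and> length ys = L \<and> sum_list ys = n} = partition_count n"
  unfolding partition_count_def
proof -
  let ?Y = "{ys :: nat list. sorted ys \<and> length ys = L \<and> sum_list ys = n}"
  let ?M = "{M :: nat multiset. 0 \<notin># M \<and> sum_mset M = n}"
  define f where "f ys = filter_mset (\<lambda>x. 0 < x) (mset ys)" for ys :: "nat list"
  define g where "g M = sorted_list_of_multiset (M + replicate_mset (L - size M) 0)" for M :: "nat multiset"
  \<comment> \<open>The number of zeros is determined by the number of positive parts; it is exactly
    the padding added by \<open>g\<close>.\<close>
  have split: "mset ys = f ys + replicate_mset (L - size (f ys)) 0" if "length ys = L" for ys
  proof -
    have "filter_mset (\<lambda>x. \<not> 0 < x) (mset ys) = replicate_mset (count (mset ys) 0) 0"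
      using filter_eq_replicate_mset[of 0 "mset ys"] by simp
    hence *: "mset ys = f ys + replicate_mset (count (mset ys) 0) 0"
      unfolding f_def by (metis multiset_partition)
    from arg_cong[OF this, of size] have "L = size (f ys) + count (mset ys) 0"
      using that by simp
    thus ?thesis using * by simp
  qed
  have 1: "\<forall>ys\<in>?Y. g (f ys) = ys"
  proof
    fix ys assume "ys \<in> ?Y"
    hence "g (f ys) = sorted_list_of_multiset (mset ys)" "sorted ys"
      unfolding g_def by (simp_all flip: split)
    thus "g (f ys) = ys" by (simp add: sorted_sort_id)
  qed
  have size: "size M \<le> n" if "M \<in> ?M" for M
  proof -
    have "size M \<le> sum_mset M" if "0 \<notin># M" for M :: "nat multiset"
      using that by (induction M) auto
    thus ?thesis using that by auto
  qed
  have 2: "\<forall>M\<in>?M. f (g M) = M"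
    by (auto simp: f_def g_def not_in_iff intro!: multiset_eqI)
  have 3: "f ` ?Y \<subseteq> ?M"
  proof (intro image_subsetI)
    fix ys assume ys: "ys \<in> ?Y"
    hence "length ys = L" "sum_mset (mset ys) = n" by (simp_all add: sum_mset_sum_list)
    hence "sum_mset (f ys) = n" using arg_cong[OF split, of ys sum_mset] by simp
    thus "f ys \<in> ?M" by (simp add: f_def)
  qed
  have 4: "g ` ?M \<subseteq> ?Y"
  proof (intro image_subsetI)
    fix M assume M: "M \<in> ?M"
    have "mset (g M) = M + replicate_mset (L - size M) 0" by (simp add: g_def)
    moreover from this have "length (g M) = size (M + replicate_mset (L - size M) 0)" by (metis size_mset)
    moreover have "sum_list (g M) = sum_mset (mset (g M))" by (simp add: sum_mset_sum_list)
    ultimately show "g M \<in> ?Y" using M size[OF M] assms by (simp add: g_def)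
  qed
  show "card ?Y = card ?M"
    by (rule bij_betw_same_card[OF bij_betw_byWitness[OF 1 2 3 4]])
qed

lemma u_eq_partition_count:
  assumes "n \<le> m + 1"
  shows "u (int m) ((m + 2) * (m + 1) div 2 + n) = partition_count n"
proof -
  have "u (int m) ((m + 2) * (m + 1) div 2 + n) =
      card {xs. sorted_wrt (<) xs \<and> (\<forall>x\<in>set xs. 0 < x) \<and> length xs = m + 1 \<and>
                sum_list xs = (m + 1 + 1) * (m + 1) div 2 + n}"
    unfolding u_def strongly_unimodal_small_size[OF assms] by (simp add: card_image inj_on_def)
  thus ?thesis unfolding card_strict_sorted_eq card_sorted_eq_partition_count[OF assms] .
qed

section \<open>The generating function\<close>

lemma summable_power_product:
  fixes x :: real
  assumes "0 \<le> x" "x < 1"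
  shows "(\<lambda>(i, j). C * (x ^ i * x ^ j)) summable_on UNIV \<times> (UNIV :: nat set)"
proof -
  have g: "((\<lambda>i. x ^ i) has_sum (1 / (1 - x))) UNIV"
    using assms by (intro norm_summable_imp_has_sum geometric_sums) (auto simp: summable_geometric)
  have "(\<lambda>(i, j). x ^ i * x ^ j) summable_on UNIV \<times> (UNIV :: nat set)"
  proof (rule summable_on_SigmaI)
    show "((\<lambda>j. case (i, j) of (i, j) \<Rightarrow> x ^ i * x ^ j) has_sum x ^ i * (1 / (1 - x))) UNIV" for i
      unfolding prod.case by (rule has_sum_cmult_right[OF g])
    show "(\<lambda>i. x ^ i * (1 / (1 - x))) summable_on UNIV"
      by (rule has_sum_imp_summable[OF has_sum_cmult_left[OF g]])
  qed (use assms in auto)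
  from summable_on_cmult_right[OF this, of C] show ?thesis
    by (simp add: case_prod_unfold)
qed

text \<open>This domination justifies each change of summation order in
  \<open>unimodal_gf\<close>.\<close>

lemma summable_power_product_bound:
  fixes f :: "nat \<times> nat \<Rightarrow> complex"
  assumes "0 \<le> x" "x < 1" "\<And>i j. norm (f (i, j)) \<le> C * (x ^ i * x ^ j)"
  shows "f summable_on UNIV \<times> UNIV"
proof (rule abs_summable_summable, rule Infinite_Sum.abs_summable_on_comparison_test')
  show "(\<lambda>(i, j). C * (x ^ i * x ^ j)) summable_on UNIV \<times> (UNIV :: nat set)"
    by (rule summable_power_product[OF assms(1,2)])
qed (use assms(3) in auto)

lemma triangular_add:
  fixes m i :: nat
  shows "(m + i) * (m + i + 1) div 2 = m * (m + 1) div 2 + (m * i + i * (i + 1) div 2)"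
proof -
  have "even (m * (m + 1))" "even (i * (i + 1))" by auto
  then obtain a b where *: "m * (m + 1) = 2 * a" "i * (i + 1) = 2 * b" by (elim dvdE)
  have "(m + i) * (m + i + 1) = m * (m + 1) + i * (i + 1) + 2 * (m * i)"
    by (simp add: algebra_simps)
  also have "\<dots> = 2 * (a + (m * i + b))" unfolding * by simp
  finally show ?thesis unfolding * by simp
qed

lemma geometric_sum_power:
  fixes q :: complex
  assumes "norm q < 1" "0 < k + m"
  shows "(\<Sum>l<k. q ^ (l * (k + m))) = (q ^ (k * (k + m)) - 1) / (q ^ (k + m) - 1)"
proof -
  have "q ^ (k + m) \<noteq> 1" using one_minus_power_nonzero[OF assms] by auto
  from geometric_sum[OF this, of k] show ?thesis by (simp add: mult.commute flip: power_mult)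
qed

text \<open>In terms of \<open>k = i + n + 1\<close> the exponent becomes linear in \<open>n\<close>
  with slope \<open>k + m\<close>, so the terms with fixed \<open>k\<close> form a geometric
  progression.\<close>

lemma unimodal_exponent_eq:
  fixes m i n :: nat
  shows "(m * i + i * (i + 1) div 2 + (m + i + 1)) + n * (3 * n + 2 * (2 * (m + i) + 1) + 3) div 2 =
   (i + n + 1) * (i + n + 1 + 1) div 2 + m * (i + n + 1) + n * (i + n + 1 + m)"
proof -
  have e: "even (i * (i + 1))" "even (n * (3 * n + 2 * (2 * (m + i) + 1) + 3))" "even ((i + n + 1) * (i + n + 1 + 1))"
    by auto
  obtain a b c where *: "i * (i + 1) = 2 * a" "n * (3 * n + 2 * (2 * (m + i) + 1) + 3) = 2 * b"
    "(i + n + 1) * (i + n + 1 + 1) = 2 * c"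
    using e by (elim dvdE)
  have "2 * (m * i + a + (m + i + 1) + b) = 2 * (c + m * (i + n + 1) + n * (i + n + 1 + m))"
    using *[symmetric] by (simp add: algebra_simps)
  thus ?thesis unfolding * by simp
qed

theorem unimodal_gf:
  fixes q :: complex and m :: nat
  assumes "norm q < 1"
  defines "t \<equiv> \<lambda>n. (- 1) ^ n * q ^ (n * (n + 1) div 2 + m * n) / (1 - q ^ (n + m)) * (q ^ (n * (n + m)) - 1)"
  obtains T where "(t has_sum T) {1..}"
    and "((\<lambda>n. of_nat (u (int m) n) * q ^ n) has_sum (q ^ (m * (m + 1) div 2) / qpoch_inf q q * T)) {1..}"
proof -
  define x where "x = norm q"
  have x: "0 \<le> x" "x < 1" using assms by (auto simp: x_def)
  \<comment> \<open>The exponent of \<open>q ^ Suc N\<close> times the triangular power, for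
    \<open>N = m + i + r\<close>, after splitting off \<open>tri\<close> and
    \<open>q ^ r\<close>.\<close>
  define e where "e i = m * i + i * (i + 1) div 2 + (m + i + 1)" for i
  define tri where "tri = q ^ (m * (m + 1) div 2)"
  define P where "P = qpoch_inf q q"
  have P: "P \<noteq> 0" using qpoch_inf_nonzero[OF assms(1)] by (simp add: P_def)
  have e_le: "i \<le> e i" for i by (simp add: e_def)
  obtain S where u_sum: "((\<lambda>n. of_nat (u (int m) n) * q ^ n) has_sum S) {1..}"
    and S: "((\<lambda>N. q ^ Suc N * pair_sum q N (int m)) has_sum S) UNIV"
    using has_sum_unimodal[OF assms(1)] by blast
  obtain C where C: "C > 0" "\<And>a b. norm (gauss q a b) \<le> C"
    using gauss_bounded[OF assms(1)] by blast

  define F where "F = (\<lambda>(i, r). (-1) ^ i * q ^ e i * (q ^ r * gauss q r (r + (2 * (m + i) + 1))))"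
  have "F summable_on UNIV \<times> UNIV"
  proof (rule summable_power_product_bound[OF x])
    show "norm (F (i, r)) \<le> C * (x ^ i * x ^ r)" for i r
    proof -
      have "x ^ e i \<le> x ^ i" using x e_le by (intro power_decreasing) auto
      hence "x ^ e i * (x ^ r * norm (gauss q r (r + (2 * (m + i) + 1)))) \<le> x ^ i * (x ^ r * C)"
        using C x by (intro mult_mono) auto
      thus ?thesis by (simp add: F_def norm_mult norm_power x_def ac_simps)
    qed
  qed
  then obtain T' where T': "(F has_sum T') (UNIV \<times> UNIV)" by (auto simp: summable_on_def)

  \<comment> \<open>With \<open>N = m + d\<close> and \<open>r = d - i\<close>, the triangle
    \<open>i \<le> d\<close> becomes the full quadrant on which \<open>F\<close> is
    summable.\<close>
  have "((\<lambda>d. q ^ Suc (m + d) * pair_sum q (m + d) (int m)) has_sum (tri * T')) UNIV"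
  proof (rule has_sum_SigmaD)
    show "((\<lambda>(d, i). tri * F (i, d - i)) has_sum (tri * T')) (SIGMA d:UNIV. {..d})"
    proof (rule iffD1[OF has_sum_reindex_bij_witness[where i = "\<lambda>(d, i). (i, d - i)" and j = "\<lambda>(i, r). (i + r, i)"]])
      show "((\<lambda>y. tri * F y) has_sum (tri * T')) (UNIV \<times> UNIV)"
        by (rule has_sum_cmult_right[OF T'])
    qed auto
    fix d
    have "q ^ Suc (m + d) * pair_sum q (m + d) (int m) = (\<Sum>i\<le>d. tri * F (i, d - i))"
      unfolding pair_sum_eq[OF assms(1)] sum_distrib_left
    proof (rule sum.cong[OF refl])
      fix i assume "i \<in> {..d}"
      then obtain r where d: "d = i + r" by (auto simp: le_iff_add)
      have pow: "q ^ Suc (m + d) * q ^ ((m + i) * (m + i + 1) div 2) = tri * q ^ e i * q ^ r"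
        unfolding triangular_add tri_def e_def power_add[symmetric] d
        by (intro arg_cong[of _ _ "power q"]) simp
      have idx: "d - i = r" "d + 2 * m + i + 1 = r + (2 * (m + i) + 1)" using d by auto
      have "q ^ Suc (m + d) * ((-1) ^ i * q ^ ((m + i) * (m + i + 1) div 2) *
          gauss q (d - i) (d + 2 * m + i + 1)) =
          (q ^ Suc (m + d) * q ^ ((m + i) * (m + i + 1) div 2)) * ((-1) ^ i * gauss q (d - i) (d + 2 * m + i + 1))"
        by (simp only: mult_ac)
      also have "\<dots> = tri * F (i, d - i)"
        unfolding pow idx F_def prod.case by (simp only: mult_ac)
      finally show "q ^ Suc (m + d) * ((-1) ^ i * q ^ ((m + i) * (m + i + 1) div 2) *
          gauss q (d - i) (d + 2 * m + i + 1)) = tri * F (i, d - i)" .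
    qed
    thus "((\<lambda>i. case (d, i) of (d, i) \<Rightarrow> tri * F (i, d - i)) has_sum
        q ^ Suc (m + d) * pair_sum q (m + d) (int m)) {..d}"
      by (intro has_sum_finiteI) auto
  qed
  moreover have "bij_betw (\<lambda>d. m + d) UNIV {m..}"
    by (rule bij_betw_byWitness[where f' = "\<lambda>N. N - m"]) auto
  ultimately have "((\<lambda>N. q ^ Suc N * pair_sum q N (int m)) has_sum (tri * T')) {m..}"
    by (rule iffD1[OF has_sum_reindex_bij_betw, rotated])
  \<comment> \<open>Terms with \<open>N < m\<close> vanish, since a rank of \<open>m\<close> needs
    at least \<open>m\<close> parts below the peak.\<close>
  moreover have "((\<lambda>N. q ^ Suc N * pair_sum q N (int m)) has_sum (tri * T')) {m..} \<longleftrightarrow>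
      ((\<lambda>N. q ^ Suc N * pair_sum q N (int m)) has_sum (tri * T')) UNIV"
    by (rule has_sum_cong_neutral) (auto simp: pair_sum_eq_0)
  ultimately have S_eq: "S = tri * T'" using has_sum_unique[OF S] by simp

  \<comment> \<open>Summing over \<open>r\<close> first leaves one \<open>rank_gf\<close> for each
    \<open>i\<close>.\<close>
  define G where "G i = (-1) ^ i * q ^ e i * rank_gf q (2 * (m + i) + 1)" for i
  have G: "(G has_sum T') UNIV"
  proof (rule has_sum_SigmaD[OF T'])
    fix i
    have "((\<lambda>r. q ^ r * gauss q r (r + (2 * (m + i) + 1))) has_sum rank_gf q (2 * (m + i) + 1)) UNIV"
      by (rule norm_summable_imp_has_sum[OF summable_norm_rank_gf_terms[OF assms(1)] rank_gf_sums[OF assms(1)]])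
    from has_sum_cmult_right[OF this] show "((\<lambda>r. F (i, r)) has_sum G i) UNIV"
      unfolding F_def G_def prod.case .
  qed

  define h where "h i n = n * (3 * n + 2 * (2 * (m + i) + 1) + 3) div 2" for i n
  have h_le: "n \<le> h i n" for i n
  proof -
    have "n * 2 \<le> n * (3 * n + 2 * (2 * (m + i) + 1) + 3)" by (intro mult_le_mono) auto
    thus ?thesis unfolding h_def by linarith
  qed
  \<comment> \<open>Multiplication by \<open>P\<close> clears the denominator, and
    \<open>rank_gf_expansion\<close> then yields a double series of pure powers.\<close>
  define H where "H = (\<lambda>(i, n). (-1) ^ i * q ^ e i * ((-1) ^ n * q ^ h i n))"
  have "H summable_on UNIV \<times> UNIV"
  proof (rule summable_power_product_bound[OF x])
    show "norm (H (i, n)) \<le> 1 * (x ^ i * x ^ n)" for i n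
    proof -
      have "x ^ e i * x ^ h i n \<le> x ^ i * x ^ n"
        using x e_le h_le by (intro mult_mono power_decreasing) auto
      thus ?thesis by (simp add: H_def norm_mult norm_power x_def)
    qed
  qed
  then obtain T where T: "(H has_sum T) (UNIV \<times> UNIV)" by (auto simp: summable_on_def)
  have "((\<lambda>i. P * G i) has_sum T) UNIV"
  proof (rule has_sum_SigmaD[OF T])
    fix i
    have "(\<lambda>n. (-1) ^ n * q ^ h i n) sums (P * rank_gf q (2 * (m + i) + 1))"
      unfolding h_def P_def by (rule rank_gf_expansion[OF assms(1)])
    moreover have "summable (\<lambda>n. norm ((-1) ^ n * q ^ h i n))"
    proof (rule summable_comparison_test')
      show "summable (\<lambda>n. x ^ n)" using x by (intro summable_geometric) auto
      show "norm (norm ((-1) ^ n * q ^ h i n)) \<le> x ^ n" for n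
        using x h_le by (auto simp: norm_mult norm_power intro!: power_decreasing simp flip: x_def)
    qed
    ultimately have "((\<lambda>n. (-1) ^ n * q ^ h i n) has_sum (P * rank_gf q (2 * (m + i) + 1))) UNIV"
      by (intro norm_summable_imp_has_sum)
    from has_sum_cmult_right[OF this] show "((\<lambda>n. H (i, n)) has_sum P * G i) UNIV"
      unfolding H_def G_def prod.case by (simp only: mult.left_commute[of P])
  qed
  hence "T = P * T'" using has_sum_cmult_right[OF G, of P] by (rule has_sum_unique)
  hence "S = tri / P * T" using P S_eq by simp
  with u_sum have "((\<lambda>n. of_nat (u (int m) n) * q ^ n) has_sum (tri / P * T)) {1..}" by simp
  moreover have "(t has_sum T) {1..}"
  proof (rule has_sum_SigmaD)
    \<comment> \<open>Regroup by \<open>k = i + n + 1\<close> and \<open>l = n\<close>; the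
      condition \<open>0 \<le> i\<close> becomes \<open>l < k\<close>, so each inner sum is
      finite.\<close>
    define K where "K = (\<lambda>(k, l). (-1) ^ (k - 1) * (q ^ (k * (k + 1) div 2 + m * k) * q ^ (l * (k + m))))"
    show "(K has_sum T) (SIGMA k:{1..}. {..<k})"
    proof (rule iffD1[OF has_sum_reindex_bij_witness[where i = "\<lambda>(k, l). (k - l - 1, l)" and j = "\<lambda>(i, n). (i + n + 1, n)"] T])
      fix y :: "nat \<times> nat"
      obtain i n where y: "y = (i, n)" by (cases y)
      have pow: "q ^ ((i + n + 1) * (i + n + 1 + 1) div 2 + m * (i + n + 1)) * q ^ (n * (i + n + 1 + m)) =
          q ^ e i * q ^ h i n"
        unfolding power_add[symmetric] e_def h_def unimodal_exponent_eq ..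
      show "K (case y of (i, n) \<Rightarrow> (i + n + 1, n)) = H y"
        unfolding y K_def H_def prod.case pow add_diff_cancel_right' power_add[of "- 1" i n]
        by (simp only: mult_ac)
    qed auto
    fix k :: nat assume k: "k \<in> {1..}"
    have "t k = (\<Sum>l<k. K (k, l))"
    proof -
      have "(\<Sum>l<k. K (k, l)) = (-1) ^ (k - 1) * (q ^ (k * (k + 1) div 2 + m * k) *
          ((q ^ (k * (k + m)) - 1) / (q ^ (k + m) - 1)))"
        unfolding K_def prod.case sum_distrib_left[symmetric] using k by (subst geometric_sum_power[OF assms(1)]) auto
      \<comment> \<open>The sign from \<open>k - 1\<close> cancels the one from reversing the
        denominator.\<close>
      also have "(-1) ^ (k - 1) = - ((-1) ^ k :: complex)" using k by (cases k) auto
      also have "(q ^ (k * (k + m)) - 1) / (q ^ (k + m) - 1) = - ((q ^ (k * (k + m)) - 1) / (1 - q ^ (k + m)))"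
        unfolding minus_divide_right minus_diff_eq ..
      finally show ?thesis unfolding t_def by simp
    qed
    thus "((\<lambda>l. K (k, l)) has_sum t k) {..<k}" by (intro has_sum_finiteI) auto
  qed
  ultimately show ?thesis by (intro that) (simp_all only: tri_def P_def)
qed

theorem theorem1p1:
  fixes m :: nat
  shows "(\<forall>q::complex. norm q < 1 \<longrightarrow>
            (\<lambda>n. of_nat (u (int m) n) * q ^ n) summable_on {1..} \<and>
            (\<lambda>n. (- 1) ^ n * q ^ (n * (n + 1) div 2 + m * n) / (1 - q ^ (n + m))
                   * (q ^ (n * (n + m)) - 1)) summable_on {1..} \<and>
            U (int m) q =
              q ^ (m * (m + 1) div 2) / qpoch_inf q q *
              (\<Sum>\<^sub>\<infinity>n\<in>{1..}. (- 1) ^ n * q ^ (n * (n + 1) div 2 + m * n) / (1 - q ^ (n + m))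
                   * (q ^ (n * (n + m)) - 1))) \<and>
         (\<forall>n::nat. n \<le> m + 1 \<longrightarrow>
            u (int m) ((m + 2) * (m + 1) div 2 + n) = partition_count n)"
proof (intro conjI allI impI)
  fix q :: complex assume "norm q < 1"
  then obtain T where T: "((\<lambda>n. (- 1) ^ n * q ^ (n * (n + 1) div 2 + m * n) / (1 - q ^ (n + m))
                   * (q ^ (n * (n + m)) - 1)) has_sum T) {1..}"
    and u: "((\<lambda>n. of_nat (u (int m) n) * q ^ n) has_sum (q ^ (m * (m + 1) div 2) / qpoch_inf q q * T)) {1..}"
    by (rule unimodal_gf)
  show "(\<lambda>n. of_nat (u (int m) n) * q ^ n) summable_on {1..}"
    by (rule has_sum_imp_summable[OF u])
  show "(\<lambda>n. (- 1) ^ n * q ^ (n * (n + 1) div 2 + m * n) / (1 - q ^ (n + m))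
                   * (q ^ (n * (n + m)) - 1)) summable_on {1..}"
    by (rule has_sum_imp_summable[OF T])
  show "U (int m) q = q ^ (m * (m + 1) div 2) / qpoch_inf q q *
              (\<Sum>\<^sub>\<infinity>n\<in>{1..}. (- 1) ^ n * q ^ (n * (n + 1) div 2 + m * n) / (1 - q ^ (n + m))
                   * (q ^ (n * (n + m)) - 1))"
    unfolding U_def infsumI[OF T] by (rule infsumI[OF u])
qed (rule u_eq_partition_count)

end
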